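(* For every $n\geq 1$, let $D_n=\mathrm{des}(s(\sigma))+1$, where $\sigma$ is chosen uniformly at random from $S_{n-1}$. Then for every $n\ge1$, \[\mathbb E(D_n)=\left(3-\sum_{j=0}^n\frac{1}{j!}\right)n,\] and this quantity is asymptotic to $(3-e)n$ as $n\to\infty$.
   Context: $S_n$ is the set of permutations of $\{1,\dots,n\}$ written in one-line notation ($S_0$ contains only the empty permutation). $\mathrm{des}(\pi)$ is the number of descents of $\pi=\pi_1\cdots\pi_n$, i.e. indices $i\in\{1,\dots,n-1\}$ with $\pi_i>\pi_{i+1}$. West's stack-sorting map $s$ is defined recursively on permutations of finite sets of positive integers: $s$ of the empty permutation is empty, and if $\pi=LmR$ with $m$ the largest entry of $\pi$, then $s(\pi)=s(L)\,s(R)\,m$. *)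

theory Defs
  imports "HOL-Probability.Probability" "HOL-Combinatorics.Multiset_Permutations"
    "HOL-Library.Landau_Symbols"
begin

text \<open>
  Permutations of a finite set \<open>A\<close> in one-line notation are the members of
  \<^const>\<open>permutations_of_set\<close>, i.e. the distinct lists whose set of entries is \<open>A\<close>.
\<close>

abbreviation Sym :: "nat \<Rightarrow> nat list set" where
  "Sym n \<equiv> permutations_of_set {1..n}"

text \<open>Descent indices are 1-based; list indexing is 0-based, hence the shift.\<close>

definition des :: "nat list \<Rightarrow> nat" where
  "des xs = card {i \<in> {1..<length xs}. xs ! (i - 1) > xs ! i}"

text \<open>
  West's stack-sorting map. If \<open>xs = L @ m # R\<close> has distinct entries with maximum \<open>m\<close>, then
  \<open>takeWhile (\<lambda>x. x \<noteq> m) xs = L\<close> and \<open>tl (dropWhile (\<lambda>x. x \<noteq> m) xs) = R\<close>. On lists with repeated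
  entries, which are irrelevant here, the split is at the first occurrence of the maximum.
\<close>

function stack_sort :: "nat list \<Rightarrow> nat list" where
  "stack_sort xs =
    (if xs = [] then []
     else let m = Max (set xs) in
       stack_sort (takeWhile (\<lambda>x. x \<noteq> m) xs) @ stack_sort (tl (dropWhile (\<lambda>x. x \<noteq> m) xs)) @ [m])"
  by pat_completeness auto

termination
proof (relation "Wellfounded.measure length")
  fix xs :: "nat list" and m
  assume ne: "xs \<noteq> []" and m: "m = Max (set xs)"
  have mem: "m \<in> set xs"
    using ne m by simp
  have "length (takeWhile (\<lambda>x. x \<noteq> m) xs) < length xs"
    using mem by (induction xs) auto
  then show "(takeWhile (\<lambda>x. x \<noteq> m) xs, xs) \<in> Wellfounded.measure length"
    by simp
  have "length (tl (dropWhile (\<lambda>x. x \<noteq> m) xs)) < length xs"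
    using ne length_dropWhile_le[of "\<lambda>x. x \<noteq> m" xs] by (cases xs) auto
  then show "(tl (dropWhile (\<lambda>x. x \<noteq> m) xs), xs) \<in> Wellfounded.measure length"
    by simp
qed simp

declare stack_sort.simps [simp del]

lemma stack_sort_Nil: "stack_sort [] = []"
  by (subst stack_sort.simps) simp

lemma stack_sort_split:
  assumes "distinct (L @ m # R)" and "\<forall>x \<in> set L \<union> set R. x < m"
  shows "stack_sort (L @ m # R) = stack_sort L @ stack_sort R @ [m]"
proof -
  have M: "Max (set (L @ m # R)) = m"
    using assms(2) by (intro Max_eqI) (auto simp: less_imp_le)
  have "takeWhile (\<lambda>x. x \<noteq> m) (L @ m # R) = L" "dropWhile (\<lambda>x. x \<noteq> m) (L @ m # R) = m # R"
    using assms(1) by (auto simp: takeWhile_append dropWhile_append)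
  then show ?thesis
    using M by (subst stack_sort.simps) (simp add: Let_def)
qed

definition D :: "nat list \<Rightarrow> nat" where
  "D \<sigma> = des (stack_sort \<sigma>) + 1"

definition expected_D :: "nat \<Rightarrow> real" where
  "expected_D n = measure_pmf.expectation (pmf_of_set (Sym (n - 1))) (\<lambda>\<sigma>. real (D \<sigma>))"

end

theory Submission
  imports Defs
begin

text \<open>
  Let \<open>E\<^sub>n = (\<Sum>j\<le>n. 1 / j!)\<close>. Delete the maximum \<open>m\<close> from a uniformly random arrangement of
  \<open>N + 1\<close> numbers: its position is uniform on \<open>0, \<dots>, N\<close>, and independently of that position the
  remaining \<open>N\<close> numbers are in uniformly random order. So in \<open>L @ m # R\<close>, given the length \<open>i\<close> of
  \<open>L\<close>, both \<open>L\<close> and \<open>R\<close> are uniformly random arrangements of their own entries. As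
  \<open>s (L @ m # R) = s L @ s R @ [m]\<close>, the descents of the image are those of \<open>s L\<close>, those of \<open>s R\<close>,
  and possibly one at the junction of \<open>s L\<close> and \<open>s R\<close>. Since \<open>s L\<close> ends with its maximum, the
  junction is a descent exactly if some entry of \<open>L\<close> exceeds the first entry of \<open>s R\<close>.

  The probability \<open>d i k\<close> of a junction descent, for lengths \<open>i\<close> and \<open>k\<close>, comes from looking at the
  position \<open>q\<close> of the maximum among the \<open>i + k\<close> entries, with \<open>k > 0\<close>. If it lies in \<open>L\<close>
  (\<open>q < i\<close>), there is a descent. If it is the first entry of \<open>R\<close>, deleting it changes nothing, which
  leaves \<open>d i (k - 1)\<close>. If it has \<open>r > 0\<close> entries of \<open>R\<close> before it, then the first entry of
  \<open>s R\<close> is determined by those \<open>r\<close> entries, which leaves \<open>d i r\<close>. Thus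
  \<open>(i + k) * d i k = i + d i (k - 1) + (\<Sum>r<k. d i r)\<close>, and the solution is
  \<open>d i k = i * i! * (E\<^bsub>i+k\<^esub> - E\<^sub>i)\<close> (\<open>sum_junction\<close>). Summing over the position of \<open>m\<close> gives
  \<open>(\<Sum>i\<le>N. d i (N - i)) = N + 1 - E\<^sub>N\<close> (\<open>sum_junction_mean\<close>), hence for the mean number \<open>a n\<close> of
  descents after sorting \<open>n\<close> numbers
  \<open>(N + 1) * a (N + 1) = 2 * (\<Sum>i\<le>N. a i) + N + 1 - E\<^sub>N\<close>, with the solution
  \<open>a n = (3 - E\<^bsub>n+1\<^esub>) * (n + 1) - 1\<close> (\<open>sum_des_stack_sort\<close>).

  Sums are taken over the arrangements of an arbitrary finite set of numbers rather than of
  \<open>{1..n}\<close>, so that the induction hypotheses apply to the entries of \<open>L\<close> and \<open>R\<close> without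
  relabelling them. For the asymptotic equivalence, \<open>3 - E\<^sub>n\<close> tends to \<open>3 - e\<close>, which is nonzero
  because \<open>e < 3\<close>.
\<close>

section \<open>Partial sums of the exponential series\<close>

definition exp_sum :: "nat \<Rightarrow> real" where
  "exp_sum n = (\<Sum>j\<le>n. 1 / fact j)"

lemma exp_sum_0: "exp_sum 0 = 1"
  by (simp add: exp_sum_def)

lemma exp_sum_Suc: "exp_sum (Suc n) = exp_sum n + 1 / fact (Suc n)"
  by (simp add: exp_sum_def)

lemma exp_sum_tendsto: "exp_sum \<longlonglongrightarrow> exp 1"
proof -
  have "(\<lambda>j. 1 / fact j :: real) sums exp 1"
    using exp_converges[of "1::real"] by (simp add: inverse_eq_divide)
  then show ?thesis
    unfolding sums_def_le exp_sum_def .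
qed

text \<open>
  The bound \<open>c - 1 / n!\<close> on the partial sums is inductive because
  \<open>2 / (n + 1)! \<le> 1 / n!\<close>. Starting at \<open>n = 3\<close> allows \<open>c = 23 / 8\<close>, leaving room below 3.
\<close>

lemma exp_1_less_3: "exp (1::real) < 3"
proof -
  have "exp_sum n \<le> 23 / 8 - 1 / fact n" if "n \<ge> 3" for n
    using that
  proof (induction n rule: dec_induct)
    case base
    then show ?case
      by (simp add: exp_sum_def numeral_3_eq_3 fact_numeral)
  next
    case (step n)
    have "2 / fact (Suc n) \<le> (1 :: real) / fact n"
      using step.hyps by (simp add: divide_simps)
    then show ?case
      using step.IH by (simp add: exp_sum_Suc del: fact_Suc)
  qed
  then have "exp_sum n \<le> 23 / 8" if "n \<ge> 3" for n
    using that by (smt (verit) divide_nonneg_nonneg fact_ge_zero)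
  then have "exp (1::real) \<le> 23 / 8"
    by (intro LIMSEQ_le_const2[OF exp_sum_tendsto]) auto
  then show ?thesis by simp
qed

section \<open>Solving the two recurrences\<close>

text \<open>
  The probability that, for a random arrangement \<open>L @ R\<close> with \<open>i\<close> entries in \<open>L\<close> and \<open>k\<close> in \<open>R\<close>,
  there is a descent between \<open>s L\<close> and \<open>s R\<close>.
\<close>

definition junction_mean :: "nat \<Rightarrow> nat \<Rightarrow> real" where
  "junction_mean i k = real i * fact i * (exp_sum (i + k) - exp_sum i)"

lemma junction_mean_0: "junction_mean i 0 = 0"
  by (simp add: junction_mean_def)

text \<open>
  The mean \<open>junction_mean i k\<close> grows by \<open>i * i! / (i + k + 1)!\<close> when \<open>k\<close> grows by one. This small
  increment, multiplied by \<open>i + k + 1\<close>, is the increment one step earlier, which is why both sides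
  change by the same amount.
\<close>

lemma junction_mean_recursion:
  "real (i + Suc k) * junction_mean i (Suc k) =
     real i + junction_mean i k + (\<Sum>r\<le>k. junction_mean i r)"
proof (induction k)
  case 0
  then show ?case
    by (simp add: junction_mean_def exp_sum_Suc add_nonneg_eq_0_iff divide_simps)
next
  case (Suc k)
  have step: "junction_mean i (Suc r) = junction_mean i r + real i * fact i / fact (Suc (i + r))" for r
    by (simp add: junction_mean_def exp_sum_Suc ring_distribs)
  have "real (i + Suc (Suc k)) * junction_mean i (Suc (Suc k))
      = real (i + Suc (Suc k)) * junction_mean i (Suc k) + real i * fact i / fact (Suc (i + k))"
  proof -
    have "fact (Suc (i + Suc k)) = real (i + Suc (Suc k)) * fact (Suc (i + k))"
      by simp
    then show ?thesis
      unfolding step[of "Suc k"] distrib_left by (simp del: fact_Suc of_nat_add of_nat_Suc)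
  qed
  also have "\<dots> = real (i + Suc k) * junction_mean i (Suc k) + junction_mean i (Suc k)
                 + (junction_mean i (Suc k) - junction_mean i k)"
    unfolding step[of k] by (simp add: distrib_right del: fact_Suc)
  also have "\<dots> = real i + junction_mean i (Suc k) + (\<Sum>r\<le>Suc k. junction_mean i r)"
    using Suc.IH by simp
  finally show ?case .
qed

text \<open>
  Passing from \<open>N\<close> to \<open>N + 1\<close> adds \<open>i * i! / (N + 1)!\<close> to each term, and
  \<open>(\<Sum>i\<le>N. i * i!) = (N + 1)! - 1\<close>.
\<close>

lemma sum_junction_mean:
  "(\<Sum>i\<le>N. junction_mean i (N - i)) = real (Suc N) - exp_sum N"
proof (induction N)
  case 0
  then show ?case
    by (simp add: junction_mean_def exp_sum_0)
next
  case (Suc N)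
  have f: "(\<Sum>i\<le>N. real i * fact i) = fact (Suc N) - 1"
    by (induction N) (simp_all add: algebra_simps)
  have "(\<Sum>i\<le>Suc N. junction_mean i (Suc N - i))
      = (\<Sum>i\<le>N. junction_mean i (N - i) + real i * fact i / fact (Suc N))"
    by (simp add: junction_mean_0, intro sum.cong refl)
       (simp add: junction_mean_def exp_sum_Suc ring_distribs Suc_diff_le)
  also have "\<dots> = real (Suc N) - exp_sum N + (fact (Suc N) - 1) / fact (Suc N)"
    by (simp only: sum.distrib Suc.IH sum_divide_distrib[symmetric] f)
  also have "\<dots> = real (Suc (Suc N)) - exp_sum (Suc N)"
    by (simp add: exp_sum_Suc diff_divide_distrib)
  finally show ?case .
qed

text \<open>The mean number of descents of \<open>s \<sigma>\<close> for a random arrangement \<open>\<sigma>\<close> of \<open>n\<close> numbers.\<close>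

definition des_mean :: "nat \<Rightarrow> real" where
  "des_mean n = (3 - exp_sum (Suc n)) * real (Suc n) - 1"

lemma des_mean_0: "des_mean 0 = 0"
  by (simp add: des_mean_def exp_sum_0 exp_sum_Suc)

text \<open>
  Subtracting consecutive instances removes the sum and leaves
  \<open>(n + 1) * a (n + 1) = (n + 2) * a n + 1 - 1 / n!\<close>, with \<open>a\<close> for \<open>des_mean\<close>. The proof writes
  \<open>1 / n!\<close> as \<open>G\<close> so that all factorials disappear.
\<close>

lemma des_mean_recursion:
  "real (Suc N) * des_mean (Suc N) = 2 * (\<Sum>i\<le>N. des_mean i) + real (Suc N) - exp_sum N"
proof (induction N)
  case 0
  then show ?case
    by (simp add: des_mean_def exp_sum_0 exp_sum_Suc fact_numeral)
next
  case (Suc N)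
  define G where "G = (1::real) / fact (Suc N)"
  have G: "1 / fact (Suc (Suc N)) = G / real (Suc (Suc N))"
       "1 / fact (Suc (Suc (Suc N))) = G / real (Suc (Suc N)) / real (Suc (Suc (Suc N)))"
    unfolding G_def by simp_all
  have d1: "des_mean (Suc N) = (3 - (exp_sum N + G + G / real (Suc (Suc N)))) * real (Suc (Suc N)) - 1"
    unfolding des_mean_def exp_sum_Suc G by (simp add: G_def)
  have d2: "des_mean (Suc (Suc N)) =
      (3 - (exp_sum N + G + G / real (Suc (Suc N)) + G / real (Suc (Suc N)) / real (Suc (Suc (Suc N)))))
        * real (Suc (Suc (Suc N))) - 1"
    unfolding des_mean_def exp_sum_Suc G by (simp add: G_def)
  have "real (Suc (Suc N)) * des_mean (Suc (Suc N))
      = real (Suc N) * des_mean (Suc N) + 2 * des_mean (Suc N) + 1 - G"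
    unfolding d1 d2 by (simp add: divide_simps) (simp add: algebra_simps)
  then show ?case
    using Suc.IH by (simp add: exp_sum_Suc G_def)
qed

section \<open>Splitting random permutations\<close>

text \<open>
  An arrangement of \<open>insert m B\<close> is the same as an arrangement of \<open>B\<close> together with the number of
  entries that precede \<open>m\<close>.
\<close>

lemma sum_permutations_insert:
  fixes f :: "'a list \<Rightarrow> 'b::comm_monoid_add"
  assumes m: "m \<notin> B"
  shows "(\<Sum>\<sigma>\<in>permutations_of_set (insert m B). f \<sigma>) =
    (\<Sum>i\<le>card B. \<Sum>\<tau>\<in>permutations_of_set B. f (take i \<tau> @ m # drop i \<tau>))"
proof -
  let ?I = "{..card B} \<times> permutations_of_set B"
  let ?ins = "\<lambda>(i, \<tau>). take i \<tau> @ m # drop i \<tau>"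
  let ?cut = "\<lambda>\<sigma>. (length (takeWhile (\<lambda>x. x \<noteq> m) \<sigma>), remove1 m \<sigma>)"
  have "(\<Sum>p\<in>?I. f (?ins p)) = (\<Sum>\<sigma>\<in>permutations_of_set (insert m B). f \<sigma>)"
  proof (rule sum.reindex_bij_witness[where j = ?ins and i = ?cut])
    fix p assume "p \<in> ?I"
    then obtain i \<tau> where p: "p = (i, \<tau>)" "i \<le> card B" "set \<tau> = B" "distinct \<tau>"
      by (auto simp: permutations_of_set_def)
    have len: "length \<tau> = card B"
      using p distinct_card by metis
    have *: "m \<notin> set (take i \<tau>)"
      using p m by (auto dest: in_set_takeD)
    have **: "takeWhile (\<lambda>x. x \<noteq> m) (take i \<tau> @ m # drop i \<tau>) = take i \<tau>"
      using * by (subst takeWhile_append2) auto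
    show "?cut (?ins p) = p"
      using p * ** len by (simp add: remove1_append)
    have "set (take i \<tau>) \<union> set (drop i \<tau>) = set \<tau>" "set (take i \<tau>) \<inter> set (drop i \<tau>) = {}"
      using p by (metis append_take_drop_id set_append, metis append_take_drop_id distinct_append)
    then show "?ins p \<in> permutations_of_set (insert m B)"
      using p m by (auto simp: permutations_of_set_def)
    show "f (?ins p) = f (?ins p)" ..
  next
    fix \<sigma> assume "\<sigma> \<in> permutations_of_set (insert m B)"
    then have \<sigma>: "set \<sigma> = insert m B" "distinct \<sigma>"
      by (auto simp: permutations_of_set_def)
    then obtain L R where LR: "\<sigma> = L @ m # R"
      using split_list[of m \<sigma>] by auto
    have B: "B = set L \<union> set R" "m \<notin> set L" "distinct (L @ R)"
      using \<sigma> m unfolding LR by auto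
    then have tw: "takeWhile (\<lambda>x. x \<noteq> m) (L @ m # R) = L"
      by (subst takeWhile_append2) auto
    have c: "card B = length L + length R"
      using B distinct_card[of "L @ R"] by simp
    show "?cut \<sigma> \<in> ?I"
      using B c tw by (simp add: LR remove1_append permutations_of_set_def)
    show "?ins (?cut \<sigma>) = \<sigma>"
      using B tw by (simp add: LR remove1_append)
  qed
  then show ?thesis
    by (simp add: sum.cartesian_product case_prod_unfold)
qed

text \<open>
  Choosing an arrangement of \<open>B\<close> amounts to choosing the set of its first \<open>i\<close> entries and then
  arranging this set and its complement independently.
\<close>

lemma sum_permutations_take_drop:
  fixes g :: "'a list \<Rightarrow> 'a list \<Rightarrow> 'b::comm_monoid_add"
  assumes fin: "finite B" and i: "i \<le> card B"
  shows "(\<Sum>\<tau>\<in>permutations_of_set B. g (take i \<tau>) (drop i \<tau>)) =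
    (\<Sum>S | S \<subseteq> B \<and> card S = i. \<Sum>L\<in>permutations_of_set S. \<Sum>R\<in>permutations_of_set (B - S). g L R)"
proof -
  let ?I = "Sigma {S. S \<subseteq> B \<and> card S = i} (\<lambda>S. permutations_of_set S \<times> permutations_of_set (B - S))"
  have "(\<Sum>(S, L, R)\<in>?I. g L R) = (\<Sum>\<tau>\<in>permutations_of_set B. g (take i \<tau>) (drop i \<tau>))"
  proof (rule sum.reindex_bij_witness[where j = "\<lambda>(S, L, R). L @ R"
        and i = "\<lambda>\<tau>. (set (take i \<tau>), take i \<tau>, drop i \<tau>)"])
    fix p assume "p \<in> ?I"
    then obtain S L R where p: "p = (S, L, R)" "S \<subseteq> B" "card S = i"
        "set L = S" "distinct L" "set R = B - S" "distinct R"
      by (auto simp: permutations_of_set_def)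
    have len: "length L = i"
      using p distinct_card by metis
    show "(\<lambda>\<tau>. (set (take i \<tau>), take i \<tau>, drop i \<tau>)) ((\<lambda>(S, L, R). L @ R) p) = p"
      using p len by simp
    show "(\<lambda>(S, L, R). L @ R) p \<in> permutations_of_set B"
      using p by (auto simp: permutations_of_set_def)
    show "(g (take i ((\<lambda>(S, L, R). L @ R) p)) (drop i ((\<lambda>(S, L, R). L @ R) p))) =
        (case p of (S, L, R) \<Rightarrow> g L R)"
      using p len by simp
  next
    fix \<tau> assume "\<tau> \<in> permutations_of_set B"
    then have \<tau>: "set \<tau> = B" "distinct \<tau>"
      by (auto simp: permutations_of_set_def)
    have len: "length \<tau> = card B"
      using \<tau> distinct_card by metis
    have "set (take i \<tau>) \<union> set (drop i \<tau>) = B" "set (take i \<tau>) \<inter> set (drop i \<tau>) = {}"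
      using \<tau> by (metis append_take_drop_id set_append, metis append_take_drop_id distinct_append)
    moreover have "card (set (take i \<tau>)) = i"
      using \<tau> len i by (simp add: distinct_card)
    ultimately show "(set (take i \<tau>), take i \<tau>, drop i \<tau>) \<in> ?I"
      using \<tau> by (auto simp: permutations_of_set_def)
    show "(\<lambda>(S, L, R). L @ R) (set (take i \<tau>), take i \<tau>, drop i \<tau>) = \<tau>"
      by simp
  qed
  moreover have "(\<Sum>(S, L, R)\<in>?I. g L R) = (\<Sum>S | S \<subseteq> B \<and> card S = i.
      \<Sum>(L, R)\<in>permutations_of_set S \<times> permutations_of_set (B - S). g L R)"
    using fin by (subst sum.Sigma) auto
  ultimately show ?thesis
    by (simp only: sum.cartesian_product)
qed

text \<open>
  If \<open>f\<close> has the same mean \<open>v\<close> over the arrangements of every \<open>i\<close>-element subset, then \<open>v\<close> is also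
  the mean of \<open>f\<close> over initial segments, because
  \<open>(card B choose i) * i! * (card B - i)! = (card B)!\<close>. Likewise for final segments in the lemma
  after this one.
\<close>

lemma sum_permutations_take:
  fixes f :: "'a list \<Rightarrow> real"
  assumes fin: "finite B" and i: "i \<le> card B"
    and avg: "\<And>S. S \<subseteq> B \<Longrightarrow> card S = i \<Longrightarrow> (\<Sum>L\<in>permutations_of_set S. f L) = fact i * v"
  shows "(\<Sum>\<tau>\<in>permutations_of_set B. f (take i \<tau>)) = fact (card B) * v"
proof -
  have "(\<Sum>\<tau>\<in>permutations_of_set B. f (take i \<tau>)) =
      (\<Sum>S | S \<subseteq> B \<and> card S = i. \<Sum>L\<in>permutations_of_set S. \<Sum>R\<in>permutations_of_set (B - S). f L)"
    using fin i by (rule sum_permutations_take_drop)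
  also have "\<dots> = (\<Sum>S | S \<subseteq> B \<and> card S = i. fact (card B - i) * (fact i * v))"
  proof (intro sum.cong refl)
    fix S assume "S \<in> {S. S \<subseteq> B \<and> card S = i}"
    then have S: "S \<subseteq> B" "card S = i" by auto
    then have "card (B - S) = card B - i" "finite (B - S)"
      using fin by (auto simp: card_Diff_subset finite_subset)
    then show "(\<Sum>L\<in>permutations_of_set S. \<Sum>R\<in>permutations_of_set (B - S). f L) =
        fact (card B - i) * (fact i * v)"
      using avg[OF S] by (simp add: sum_distrib_left[symmetric])
  qed
  also have "\<dots> = real (card B choose i) * (fact (card B - i) * (fact i * v))"
    using n_subsets[OF fin, of i] by simp
  also have "\<dots> = fact (card B) * v"
    using i by (simp add: binomial_fact)
  finally show ?thesis .
qed

lemma sum_permutations_drop: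
  fixes f :: "'a list \<Rightarrow> real"
  assumes fin: "finite B" and i: "i \<le> card B"
    and avg: "\<And>S. S \<subseteq> B \<Longrightarrow> card S = card B - i \<Longrightarrow>
      (\<Sum>R\<in>permutations_of_set S. f R) = fact (card B - i) * v"
  shows "(\<Sum>\<tau>\<in>permutations_of_set B. f (drop i \<tau>)) = fact (card B) * v"
proof -
  have "(\<Sum>\<tau>\<in>permutations_of_set B. f (drop i \<tau>)) =
      (\<Sum>S | S \<subseteq> B \<and> card S = i. \<Sum>L\<in>permutations_of_set S. \<Sum>R\<in>permutations_of_set (B - S). f R)"
    using fin i by (rule sum_permutations_take_drop)
  also have "\<dots> = (\<Sum>S | S \<subseteq> B \<and> card S = i. fact i * (fact (card B - i) * v))"
  proof (intro sum.cong refl)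
    fix S assume "S \<in> {S. S \<subseteq> B \<and> card S = i}"
    then have S: "S \<subseteq> B" "card S = i" "finite S"
      using fin finite_subset[of S B] by auto
    then have "card (B - S) = card B - i"
      using fin by (auto simp: card_Diff_subset)
    then show "(\<Sum>L\<in>permutations_of_set S. \<Sum>R\<in>permutations_of_set (B - S). f R) =
        fact i * (fact (card B - i) * v)"
      using avg[of "B - S"] S by simp
  qed
  also have "\<dots> = real (card B choose i) * (fact i * (fact (card B - i) * v))"
    using n_subsets[OF fin, of i] by simp
  also have "\<dots> = fact (card B) * v"
    using i by (simp add: binomial_fact)
  finally show ?thesis .
qed

section \<open>Descents of the sorted list\<close>

lemma des_eq_sum: "des xs = (\<Sum>i\<in>{1..<length xs}. of_bool (xs ! i < xs ! (i - 1)))"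
  by (simp add: des_def sum_of_bool_eq Int_def)

lemma des_Cons:
  "des (x # xs) = des xs + of_bool (xs \<noteq> [] \<and> hd xs < x)"
proof (cases "xs = []")
  case True
  then show ?thesis by (simp add: des_def)
next
  case False
  have "{1..<length (x # xs)} = insert 1 (Suc ` {1..<length xs})"
    using False by (cases xs) (auto simp: image_Suc_atLeastLessThan)
  then have "des (x # xs) = of_bool ((x # xs) ! 1 < x) +
      (\<Sum>i\<in>{1..<length xs}. of_bool ((x # xs) ! Suc i < (x # xs) ! i))"
    unfolding des_eq_sum by (simp only:) (subst sum.insert,
      auto simp: sum.reindex simp del: sum_of_bool_eq image_Suc_atLeastLessThan)
  also have "(\<Sum>i\<in>{1..<length xs}. of_bool ((x # xs) ! Suc i < (x # xs) ! i)) = des xs"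
    unfolding des_eq_sum by (intro sum.cong refl) (simp add: nth_Cons_pos del: sum_of_bool_eq)
  finally show ?thesis
    using False by (simp add: hd_conv_nth)
qed

lemma des_append:
  "des (xs @ ys) = des xs + des ys + of_bool (xs \<noteq> [] \<and> ys \<noteq> [] \<and> hd ys < last xs)"
  by (induction xs) (auto simp: des_Cons des_def[of "[]"])

lemma set_stack_sort: "set (stack_sort xs) = set xs"
proof (induction xs rule: stack_sort.induct)
  case (1 xs)
  show ?case
  proof (cases "xs = []")
    case True
    then show ?thesis by (simp add: stack_sort_Nil)
  next
    case False
    define m where "m = Max (set xs)"
    have "m \<in> set xs"
      using False by (simp add: m_def)
    then have d: "dropWhile (\<lambda>x. x \<noteq> m) xs = m # tl (dropWhile (\<lambda>x. x \<noteq> m) xs)"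
      by (metis (mono_tags, lifting) dropWhile_eq_Nil_conv hd_dropWhile list.collapse)
    have "set xs = set (takeWhile (\<lambda>x. x \<noteq> m) xs @ m # tl (dropWhile (\<lambda>x. x \<noteq> m) xs))"
      by (subst d[symmetric]) (simp only: takeWhile_dropWhile_id)
    moreover have "stack_sort xs = stack_sort (takeWhile (\<lambda>x. x \<noteq> m) xs) @
        stack_sort (tl (dropWhile (\<lambda>x. x \<noteq> m) xs)) @ [m]"
      using False by (subst stack_sort.simps) (simp add: Let_def m_def)
    ultimately show ?thesis
      using 1[OF False m_def] by simp
  qed
qed

lemma stack_sort_eq_Nil_iff: "stack_sort xs = [] \<longleftrightarrow> xs = []"
  using set_stack_sort[of xs] by (metis set_empty)

lemma last_stack_sort: "xs \<noteq> [] \<Longrightarrow> last (stack_sort xs) = Max (set xs)"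
  by (subst stack_sort.simps) (simp add: Let_def)

text \<open>
  For disjoint \<open>L\<close> and \<open>R\<close>, whether concatenating \<open>s L\<close> and \<open>s R\<close> creates a descent. The last entry
  of \<open>s L\<close> is avoided: it is the maximum of \<open>L\<close>, so it exceeds a number exactly if some entry of \<open>L\<close>
  does, and in this form an empty \<open>L\<close> gives no descent, as it should.
\<close>

definition junction :: "nat list \<Rightarrow> nat list \<Rightarrow> bool" where
  "junction L R \<longleftrightarrow> R \<noteq> [] \<and> (\<exists>x\<in>set L. hd (stack_sort R) < x)"

lemma des_stack_sort_split:
  assumes "distinct (L @ m # R)" and "\<forall>x \<in> set L \<union> set R. x < m"
  shows "des (stack_sort (L @ m # R)) =
    des (stack_sort L) + des (stack_sort R) + of_bool (junction L R)"
proof -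
  have last_less: "\<not> m < last (stack_sort X)" if "X \<noteq> []" "set X \<subseteq> set L \<union> set R" for X
    using that assms(2) by (simp add: last_stack_sort subset_iff not_less less_imp_le)
  have "des (stack_sort R @ [m]) = des (stack_sort R)"
    using last_less[of R] by (cases "R = []") (simp_all add: des_append des_def[of "[_]"] stack_sort_eq_Nil_iff)
  moreover have "L \<noteq> [] \<and> hd (stack_sort R @ [m]) < last (stack_sort L) \<longleftrightarrow> junction L R"
  proof (cases "L = [] \<or> R = []")
    case True
    then show ?thesis
      using last_less[of L] by (auto simp: junction_def stack_sort_Nil)
  next
    case False
    then show ?thesis
      by (simp add: junction_def stack_sort_eq_Nil_iff last_stack_sort Max_gr_iff)
  qed
  ultimately show ?thesis
    unfolding stack_sort_split[OF assms]
    by (subst des_append) (simp add: stack_sort_eq_Nil_iff)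
qed

section \<open>The mean number of junction descents\<close>

text \<open>
  Induction on the length \<open>k\<close> of the right part, by the position \<open>q\<close> of the maximum \<open>m\<close>. It is
  inserted into an arrangement \<open>\<tau>\<close> of the other entries. In the case \<open>q > i\<close> only the first \<open>q\<close>
  entries of \<open>\<tau>\<close> matter. These form an arrangement of an unknown subset, so the
  induction hypothesis is needed for all sets of a given size.
\<close>

lemma sum_junction:
  assumes "finite B" and "card B = i + k"
  shows "(\<Sum>\<tau>\<in>permutations_of_set B. of_bool (junction (take i \<tau>) (drop i \<tau>))) =
    fact (i + k) * junction_mean i k"
  using assms
proof (induction k arbitrary: B rule: less_induct)
  case (less k)
  show ?case
  proof (cases k)
    case 0
    have "\<not> junction (take i \<tau>) (drop i \<tau>)" if "\<tau> \<in> permutations_of_set B" for \<tau>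
      using that 0 less.prems distinct_card[of \<tau>] by (auto simp: junction_def permutations_of_set_def)
    then show ?thesis
      by (simp add: 0 junction_mean_0)
  next
    case (Suc k')
    define m where "m = Max B"
    define C where "C = B - {m}"
    have "m \<in> B"
      unfolding m_def using less.prems Suc by (intro Max_in) auto
    then have B: "m \<in> B" "B = insert m C" "m \<notin> C" "finite C"
      using less.prems by (auto simp: C_def)
    have less_m: "x < m" if "x \<in> C" for x
      using that less.prems Max_ge[of B x] by (auto simp: m_def C_def less_le)
    have cC: "card C = i + k'"
      using B less.prems Suc by simp
    define ins where "ins q \<tau> = take q \<tau> @ m # drop q \<tau>" for q \<tau>
    define J where "J \<tau> = (of_bool (junction (take i \<tau>) (drop i \<tau>)) :: real)" for \<tau>
    have len: "length \<tau> = i + k'" and set: "set \<tau> = C" and dist: "distinct \<tau>"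
      if "\<tau> \<in> permutations_of_set C" for \<tau>
      using that cC distinct_card[of \<tau>] by (auto simp: permutations_of_set_def)
    have split_R: "stack_sort (R1 @ m # R2) = stack_sort R1 @ stack_sort R2 @ [m]"
      if "distinct (R1 @ R2)" "set (R1 @ R2) \<subseteq> C" for R1 R2
      using that less_m B by (intro stack_sort_split) auto
    \<comment> \<open>The maximum is on the left: it exceeds whatever \<open>s R\<close> starts with.\<close>
    have left: "(\<Sum>\<tau>\<in>permutations_of_set C. J (ins q \<tau>)) = fact (i + k')" if q: "q < i" for q
    proof -
      have "J (ins q \<tau>) = 1" if \<tau>: "\<tau> \<in> permutations_of_set C" for \<tau>
      proof -
        have dr: "drop i (ins q \<tau>) = drop (i - 1) \<tau>"
          using q len[OF \<tau>] by (cases i) (auto simp: ins_def Suc_diff_le)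
        have "m \<in> set (take i (ins q \<tau>))"
          using q len[OF \<tau>] by (cases "i - q") (auto simp: ins_def min_def)
        moreover have ne: "drop (i - 1) \<tau> \<noteq> []"
          using q len[OF \<tau>] by simp
        moreover have "hd (stack_sort (drop (i - 1) \<tau>)) \<in> set (drop (i - 1) \<tau>)"
          using ne set_stack_sort stack_sort_eq_Nil_iff list.set_sel(1) by metis
        then have "hd (stack_sort (drop (i - 1) \<tau>)) < m"
          using set[OF \<tau>] by (auto intro!: less_m dest: in_set_dropD)
        ultimately show ?thesis
          by (auto simp: J_def junction_def dr)
      qed
      then show ?thesis
        using B cC by simp
    qed
    \<comment> \<open>The right part is \<open>m # R\<close>. Then \<open>s (m # R) = s R @ [m]\<close> starts like \<open>s R\<close>, unless \<open>R\<close> is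
      empty, when neither \<open>m # R\<close> nor \<open>R\<close> gives a descent.\<close>
    have mid: "(\<Sum>\<tau>\<in>permutations_of_set C. J (ins i \<tau>)) = fact (i + k') * junction_mean i k'"
    proof -
      have "J (ins i \<tau>) = J \<tau>" if \<tau>: "\<tau> \<in> permutations_of_set C" for \<tau>
      proof -
        have "stack_sort ([] @ m # drop i \<tau>) = stack_sort [] @ stack_sort (drop i \<tau>) @ [m]"
          using set[OF \<tau>] dist[OF \<tau>] by (intro split_R) (auto dest: in_set_dropD)
        moreover have "take i (ins i \<tau>) = take i \<tau>" "drop i (ins i \<tau>) = m # drop i \<tau>"
          using len[OF \<tau>] by (auto simp: ins_def)
        moreover have "\<not> m < x" if "x \<in> set (take i \<tau>)" for x
          using that set[OF \<tau>] less_m[of x] by (auto dest: in_set_takeD)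
        ultimately show ?thesis
          by (cases "drop i \<tau> = []")
             (auto simp: J_def junction_def stack_sort_Nil stack_sort_eq_Nil_iff)
      qed
      then show ?thesis
        using less.IH[of k' C] B cC Suc by (simp add: J_def)
    qed
    \<comment> \<open>The right part has \<open>Suc r\<close> entries before \<open>m\<close>, and the first entry of its image comes from
      sorting these.\<close>
    have right: "(\<Sum>\<tau>\<in>permutations_of_set C. J (ins (i + Suc r) \<tau>)) =
        fact (i + k') * junction_mean i (Suc r)" if r: "r < k'" for r
    proof -
      let ?q = "i + Suc r"
      have "J (ins ?q \<tau>) = J (take ?q \<tau>)" if \<tau>: "\<tau> \<in> permutations_of_set C" for \<tau>
      proof -
        let ?R = "drop i (take ?q \<tau>)"
        have "take ?q \<tau> @ drop ?q \<tau> = \<tau>"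
          by simp
        then have "take i (take ?q \<tau>) @ (?R @ drop ?q \<tau>) = \<tau>"
          by (metis append.assoc append_take_drop_id)
        then have "distinct (?R @ drop ?q \<tau>)" "set (?R @ drop ?q \<tau>) \<subseteq> C"
          using set[OF \<tau>] dist[OF \<tau>] by (metis distinct_append, metis Un_upper2 set_append)
        then have "stack_sort (?R @ m # drop ?q \<tau>) = stack_sort ?R @ stack_sort (drop ?q \<tau>) @ [m]"
          by (rule split_R)
        moreover have "take i (ins ?q \<tau>) = take i (take ?q \<tau>)"
          "drop i (ins ?q \<tau>) = ?R @ m # drop ?q \<tau>" "?R \<noteq> []"
          using len[OF \<tau>] r by (auto simp: ins_def)
        ultimately show ?thesis
          by (auto simp: J_def junction_def stack_sort_eq_Nil_iff)
      qed
      then have "(\<Sum>\<tau>\<in>permutations_of_set C. J (ins ?q \<tau>)) = (\<Sum>\<tau>\<in>permutations_of_set C. J (take ?q \<tau>))"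
        by simp
      also have "\<dots> = fact (card C) * junction_mean i (Suc r)"
      proof (rule sum_permutations_take)
        fix S assume "S \<subseteq> C" "card S = ?q"
        then show "(\<Sum>\<tau>\<in>permutations_of_set S. J \<tau>) = fact ?q * junction_mean i (Suc r)"
          unfolding J_def using r Suc B finite_subset[of S C] by (intro less.IH) auto
      qed (use B cC r in auto)
      finally show ?thesis
        by (simp add: cC)
    qed
    have "(\<Sum>\<tau>\<in>permutations_of_set B. J \<tau>) =
        (\<Sum>q\<le>i + k'. \<Sum>\<tau>\<in>permutations_of_set C. J (ins q \<tau>))"
      using sum_permutations_insert[OF B(3), of J] by (simp add: B(2)[symmetric] cC ins_def)
    also have "{..i + k'} = {..<i} \<union> (insert i ((\<lambda>r. i + Suc r) ` {..<k'}))"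
    proof (intro set_eqI iffI)
      fix q assume "q \<in> {..i + k'}"
      then show "q \<in> {..<i} \<union> (insert i ((\<lambda>r. i + Suc r) ` {..<k'}))"
        using le_Suc_ex[of "Suc i" q] by (cases "q \<le> i") (auto simp: image_iff)
    qed auto
    also have "(\<Sum>q\<in>\<dots>. \<Sum>\<tau>\<in>permutations_of_set C. J (ins q \<tau>)) =
       real i * fact (i + k') + (fact (i + k') * junction_mean i k' +
       (\<Sum>r<k'. fact (i + k') * junction_mean i (Suc r)))"
      by (subst sum.union_disjoint, force, force, force, subst sum.insert, force, force,
          subst sum.reindex) (auto simp: inj_on_def left mid right[unfolded add_Suc_right])
    also have "\<dots> = fact (i + k') * (real i + junction_mean i k' + (\<Sum>r\<le>k'. junction_mean i r))"
      by (simp add: sum.atMost_shift junction_mean_0 sum_distrib_left algebra_simps)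
    also have "\<dots> = fact (i + Suc k') * junction_mean i (Suc k')"
      by (subst junction_mean_recursion[symmetric]) simp
    finally show ?thesis
      by (simp add: J_def Suc)
  qed
qed

section \<open>The mean number of descents\<close>

text \<open>
  Induction on \<open>card A\<close>: with \<open>i\<close> entries to the left of the maximum, the three kinds of descents
  contribute the means \<open>des_mean i\<close>, \<open>des_mean (N - i)\<close> and \<open>junction_mean i (N - i)\<close>, and the
  recurrences add these up.
\<close>

lemma sum_des_stack_sort:
  assumes "finite A"
  shows "(\<Sum>\<sigma>\<in>permutations_of_set A. real (des (stack_sort \<sigma>))) = fact (card A) * des_mean (card A)"
  using assms
proof (induction "card A" arbitrary: A rule: less_induct)
  case less
  show ?case
  proof (cases "card A")
    case 0
    then show ?thesis
      using less.prems by (simp add: stack_sort_Nil des_def des_mean_0)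
  next
    case (Suc N)
    define m where "m = Max A"
    define B where "B = A - {m}"
    have "m \<in> A"
      unfolding m_def using less.prems Suc by (intro Max_in) auto
    then have A: "m \<in> A" "A = insert m B" "m \<notin> B" "finite B"
      using less.prems by (auto simp: B_def)
    have less_m: "x < m" if "x \<in> B" for x
      using that less.prems Max_ge[of A x] by (auto simp: m_def B_def less_le)
    have cB: "card B = N"
      using A less.prems Suc by simp
    let ?P = "permutations_of_set B"
    have "(\<Sum>\<sigma>\<in>permutations_of_set A. real (des (stack_sort \<sigma>))) =
        (\<Sum>i\<le>N. \<Sum>\<tau>\<in>?P. real (des (stack_sort (take i \<tau> @ m # drop i \<tau>))))"
      using sum_permutations_insert[OF A(3)] by (simp add: A(2)[symmetric] cB)
    also have "\<dots> = (\<Sum>i\<le>N. \<Sum>\<tau>\<in>?P. real (des (stack_sort (take i \<tau>))) +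
        real (des (stack_sort (drop i \<tau>))) + of_bool (junction (take i \<tau>) (drop i \<tau>)))"
    proof (intro sum.cong refl)
      fix i \<tau> assume \<tau>: "\<tau> \<in> ?P"
      define L R where "L = take i \<tau>" and "R = drop i \<tau>"
      have "distinct (L @ R)" "set (L @ R) = B"
        using \<tau> by (simp_all only: L_def R_def append_take_drop_id permutations_of_set_def mem_Collect_eq)
      then have "distinct (L @ m # R)" "\<forall>x \<in> set L \<union> set R. x < m"
        using A(3) less_m by auto
      then show "real (des (stack_sort (take i \<tau> @ m # drop i \<tau>))) =
          real (des (stack_sort (take i \<tau>))) + real (des (stack_sort (drop i \<tau>))) +
          of_bool (junction (take i \<tau>) (drop i \<tau>))"
        by (simp add: des_stack_sort_split L_def R_def)
    qed
    also have "\<dots> = (\<Sum>i\<le>N. fact N * des_mean i + fact N * des_mean (N - i) +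
        fact N * junction_mean i (N - i))"
    proof (intro sum.cong refl)
      fix i assume "i \<in> {..N}"
      then have i: "i \<le> N" by simp
      have avg: "(\<Sum>\<sigma>\<in>permutations_of_set S. real (des (stack_sort \<sigma>))) = fact j * des_mean j"
        if "S \<subseteq> B" "card S = j" "j \<le> N" for S j
        using that less.hyps[of S] finite_subset[of S B] A Suc by auto
      have "(\<Sum>\<tau>\<in>?P. real (des (stack_sort (take i \<tau>)))) = fact (card B) * des_mean i"
        using i cB A Suc by (intro sum_permutations_take avg) auto
      moreover have "(\<Sum>\<tau>\<in>?P. real (des (stack_sort (drop i \<tau>)))) = fact (card B) * des_mean (N - i)"
        using i cB A(4) by (intro sum_permutations_drop) (simp_all add: avg)
      moreover have "(\<Sum>\<tau>\<in>?P. of_bool (junction (take i \<tau>) (drop i \<tau>))) =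
          fact (i + (N - i)) * junction_mean i (N - i)"
        using i cB A by (intro sum_junction) auto
      ultimately show "(\<Sum>\<tau>\<in>?P. real (des (stack_sort (take i \<tau>))) +
          real (des (stack_sort (drop i \<tau>))) + of_bool (junction (take i \<tau>) (drop i \<tau>))) =
          fact N * des_mean i + fact N * des_mean (N - i) + fact N * junction_mean i (N - i)"
        using i cB by (simp add: sum.distrib)
    qed
    also have "\<dots> = fact N * ((\<Sum>i\<le>N. des_mean i) + (\<Sum>i\<le>N. des_mean (N - i)) +
        (\<Sum>i\<le>N. junction_mean i (N - i)))"
      by (simp add: sum.distrib sum_distrib_left algebra_simps)
    also have "(\<Sum>i\<le>N. des_mean (N - i)) = (\<Sum>i\<le>N. des_mean i)"
      by (rule sum.nat_diff_reindex[symmetric, of des_mean "Suc N", simplified lessThan_Suc_atMost diff_Suc_Suc, symmetric])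
    also have "fact N * ((\<Sum>i\<le>N. des_mean i) + (\<Sum>i\<le>N. des_mean i) + (\<Sum>i\<le>N. junction_mean i (N - i))) =
        fact N * (real (Suc N) * des_mean (Suc N))"
      unfolding sum_junction_mean des_mean_recursion by simp
    finally show ?thesis
      by (simp add: Suc mult_ac)
  qed
qed

lemma expected_D_eq: "n \<ge> 1 \<Longrightarrow> expected_D n = (3 - exp_sum n) * real n"
proof -
  assume n: "n \<ge> 1"
  have "(\<Sum>\<sigma>\<in>Sym (n - 1). real (D \<sigma>)) = fact (n - 1) * (des_mean (n - 1) + 1)"
    using sum_des_stack_sort[of "{1..n - 1}"] by (simp add: D_def sum.distrib distrib_left)
  then have "expected_D n = des_mean (n - 1) + 1"
    unfolding expected_D_def by (subst integral_pmf_of_set) auto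
  then show ?thesis
    using n by (simp add: des_mean_def)
qed

theorem theorem7p9:
  shows "(\<forall>n\<ge>1. expected_D n = (3 - (\<Sum>j=0..n. 1 / fact j)) * real n)
    \<and> expected_D \<sim>[at_top] (\<lambda>n. (3 - exp 1) * real n)"
proof
  show "\<forall>n\<ge>1. expected_D n = (3 - (\<Sum>j=0..n. 1 / fact j)) * real n"
    by (simp add: expected_D_eq exp_sum_def atLeast0AtMost)
  have "(\<lambda>n. 3 - exp_sum n) \<longlonglongrightarrow> 3 - exp 1"
    by (intro tendsto_intros exp_sum_tendsto)
  then have "(\<lambda>n. 3 - exp_sum n) \<sim>[at_top] (\<lambda>n. 3 - exp 1)"
    using exp_1_less_3 by (intro tendsto_imp_asymp_equiv_const) auto
  then have "(\<lambda>n. (3 - exp_sum n) * real n) \<sim>[at_top] (\<lambda>n. (3 - exp 1) * real n)"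
    by (intro asymp_equiv_intros)
  moreover have "\<forall>\<^sub>F n in at_top. expected_D n = (3 - exp_sum n) * real n"
    using eventually_ge_at_top[of 1] by eventually_elim (rule expected_D_eq)
  ultimately show "expected_D \<sim>[at_top] (\<lambda>n. (3 - exp 1) * real n)"
    by (subst asymp_equiv_cong) auto
qed

end
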